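(* Let $k>0$ and let $C=\{\sigma\in\mathbb{M} : f_T(\sigma)\le k\}$ (Tresca yield domain), where $f_T(\sigma)=\frac12(\lambda_1(\sigma)-\lambda_3(\sigma))$. Let $\sigma\in\mathbb{M}$ satisfy $f_T(\sigma)=k$ and $\lambda_1(\sigma)>\lambda_2(\sigma)>\lambda_3(\sigma)$. Let $v_1(\sigma)$ and $v_3(\sigma)$ be unit eigenvectors of $\sigma$ associated with $\lambda_1(\sigma)$ and $\lambda_3(\sigma)$, respectively. Then, for $\dot\varepsilon,\dot\varepsilon^{e},\dot\varepsilon^{p},\dot\sigma\in\mathbb{M}$, the rules $$\dot\varepsilon^{e}=\Pi_{T(C,\sigma)}\dot\varepsilon,\qquad \dot\varepsilon^{p}=\Pi_{N(C,\sigma)}\dot\varepsilon,\qquad \dot\sigma=\Pi_{T(C,\sigma)}\mathbb{H}(\dot\varepsilon)$$ can be rewritten as (i.e. are equivalent to) $$\dot\varepsilon^{p}=q(\dot\varepsilon;\sigma)\,[v_1(\sigma)\otimes v_1(\sigma)-v_3(\sigma)\otimes v_3(\sigma)],\qquad \dot\varepsilon^{e}=\dot\varepsilon-\dot\varepsilon^{p},$$ $$\dot\sigma=\lambda\,\mathrm{tr}(\dot\varepsilon)I+2\mu\left(\dot\varepsilon-q(\dot\varepsilon;\sigma)\,[v_1(\sigma)\otimes v_1(\sigma)-v_3(\sigma)\otimes v_3(\sigma)]\right),$$ with $$q(\dot\varepsilon;\sigma)=\tfrac12\max\big(0,\dot\varepsilon:(v_1(\sigma)\otimes v_1(\sigma)-v_3(\sigma)\otimes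 v_3(\sigma))\big)=\tfrac12\max\big(0,\overline{\dot\varepsilon}:(v_1(\sigma)\otimes v_1(\sigma)-v_3(\sigma)\otimes v_3(\sigma))\big).$$
   Context: $\mathbb{M}$ is the space of real symmetric $3\times3$ matrices with scalar product $\tau:\eta=\mathrm{tr}(\tau\eta)$ and associated (Frobenius) norm $\|\cdot\|$; $I$ is the identity matrix. For $\sigma\in\mathbb{M}$, $\lambda_1(\sigma)\ge\lambda_2(\sigma)\ge\lambda_3(\sigma)$ are its eigenvalues in decreasing order. For $x,y\in\mathbb{R}^3$, $x\otimes y=xy^t$. $\overline\tau=\tau-\frac{\mathrm{tr}(\tau)}{3}I$ is the deviator of $\tau\in\mathbb{M}$. The elasticity operator is $\mathbb{H}(\tau)=2\mu\tau+\lambda\,\mathrm{tr}(\tau)I$, with constants $\lambda>0$, $\mu>0$ (the constant $\lambda$ without subscript is unrelated to the eigenvalues $\lambda_i(\cdot)$). For a nonempty convex set $K\subset\mathbb{M}$ and $\sigma\in K$, the tangent cone is $T(K,\sigma)=\overline{\{\alpha(\eta-\sigma) : \eta\in K,\ \alpha>0\}}$ and the normal cone is $N(K,\sigma)=\{\eta\in\mathbb{M} : \tau:\eta\le 0\ \forall\tau\in T(K,\sigma)\}$. $\Pi_K$ denotes the orthogonal projection onto a nonempty closed convex set $K$. Here $\dot\varepsilon,\dot\varepsilon^e,\dot\varepsilon^p,\dot\sigma$ are the strain rate, elastic strain rate, plastic strain rate and stress rate; the statement concerns them simply as elements of $\mathbb{M}$. *)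

theory Defs
  imports "HOL-Analysis.Analysis" "HOL-Computational_Algebra.Polynomial"
begin

definition sym_mats :: "(real^3^3) set" where
  "sym_mats = {A. transpose A = A}"

definition ddot :: "real^3^3 \<Rightarrow> real^3^3 \<Rightarrow> real" where
  "ddot A B = trace (A ** B)"

text \<open>On symmetric matrices, \<^const>\<open>ddot\<close> is the inner product of the library instance on
  \<^typ>\<open>real^3^3\<close>, so \<^const>\<open>norm\<close>, \<^const>\<open>dist\<close> and \<^const>\<open>closest_point\<close> refer to the
  Frobenius norm.\<close>

lemma ddot_eq_inner:
  assumes "A \<in> sym_mats"
  shows "ddot A B = A \<bullet> B"
proof -
  have "A $ i $ j = A $ j $ i" for i j
    using assms by (metis (mono_tags) mem_Collect_eq sym_mats_def transpose_def vec_lambda_beta)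
  then show ?thesis
    by (simp add: ddot_def trace_def matrix_matrix_mult_def inner_vec_def sum_3)
qed

lemma norm_eq_sqrt_ddot:
  assumes "A \<in> sym_mats"
  shows "norm A = sqrt (ddot A A)"
  by (simp add: ddot_eq_inner[OF assms] norm_eq_sqrt_inner)

definition charpoly :: "real^'n^'n \<Rightarrow> real poly" where
  "charpoly A = det (\<chi> i j. (if i = j then [:0, 1:] else 0) - [:A $ i $ j:])"

text \<open>\<open>eigval A i\<close> is the \<open>i\<close>-th largest eigenvalue (\<open>i\<close> starting from 1), counted with
  multiplicity; it is meaningful when all eigenvalues are real, as for symmetric \<open>A\<close>.\<close>

definition eigval :: "real^'n^'n \<Rightarrow> nat \<Rightarrow> real" where
  "eigval A i = rev (sorted_list_of_multiset (proots (charpoly A))) ! (i - 1)"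

lemma poly_charpoly: "poly (charpoly A) t = det (mat t - A)"
proof -
  have "poly (of_int k) t = of_int k" for k :: int
    by (cases k rule: int_cases2) (simp_all add: of_nat_poly)
  then show ?thesis
    unfolding charpoly_def det_def
    by (auto simp: poly_sum poly_prod mat_def intro!: sum.cong prod.cong)
qed

lemma poly_charpoly_eq_0_iff:
  "poly (charpoly A) t = 0 \<longleftrightarrow> (\<exists>v. v \<noteq> 0 \<and> A *v v = t *\<^sub>R v)"
proof -
  have *: "(mat t - A) *v v = 0 \<longleftrightarrow> A *v v = t *\<^sub>R v" for v
  proof -
    have "mat t *v v = t *\<^sub>R v"
      by (simp add: vec_eq_iff mat_def matrix_vector_mult_def if_distrib[of "\<lambda>x. x * _"] cong: if_cong)
    then show ?thesis
      by (auto simp: matrix_vector_mult_diff_rdistrib)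
  qed
  have "det (mat t - A) \<noteq> 0 \<longleftrightarrow> (\<forall>v. (mat t - A) *v v = 0 \<longrightarrow> v = 0)"
    by (metis invertible_det_nz invertible_left_inverse matrix_left_invertible_ker)
  then show ?thesis
    using * by (auto simp: poly_charpoly)
qed

definition f_T :: "real^3^3 \<Rightarrow> real" where
  "f_T \<sigma> = (eigval \<sigma> 1 - eigval \<sigma> 3) / 2"

definition tresca :: "real \<Rightarrow> (real^3^3) set" where
  "tresca k = {\<sigma> \<in> sym_mats. f_T \<sigma> \<le> k}"

text \<open>Since \<^const>\<open>sym_mats\<close> is a closed subspace, the closure taken in \<^typ>\<open>real^3^3\<close> is the
  closure in the space of symmetric matrices.\<close>

definition tangent_cone :: "(real^3^3) set \<Rightarrow> real^3^3 \<Rightarrow> (real^3^3) set" where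
  "tangent_cone K \<sigma> = closure {\<alpha> *\<^sub>R (\<eta> - \<sigma>) | \<alpha> \<eta>. \<eta> \<in> K \<and> \<alpha> > 0}"

definition normal_cone :: "(real^3^3) set \<Rightarrow> real^3^3 \<Rightarrow> (real^3^3) set" where
  "normal_cone K \<sigma> = {\<eta> \<in> sym_mats. \<forall>\<tau> \<in> tangent_cone K \<sigma>. ddot \<tau> \<eta> \<le> 0}"

definition deviator :: "real^3^3 \<Rightarrow> real^3^3" where
  "deviator \<tau> = \<tau> - (trace \<tau> / 3) *\<^sub>R mat 1"

definition elasticity :: "real \<Rightarrow> real \<Rightarrow> real^3^3 \<Rightarrow> real^3^3" where
  "elasticity lam mu \<tau> = (2 * mu) *\<^sub>R \<tau> + (lam * trace \<tau>) *\<^sub>R mat 1"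

definition tensor :: "real^3 \<Rightarrow> real^3 \<Rightarrow> real^3^3" where
  "tensor x y = (\<chi> i j. x $ i * y $ j)"

text \<open>The multiplier \<open>q(\<epsilon>; \<sigma>)\<close> depends on \<open>\<sigma>\<close> only through the two unit eigenvectors, which are
  passed explicitly because they are determined only up to sign.\<close>

definition q_mult :: "real^3^3 \<Rightarrow> real^3 \<Rightarrow> real^3 \<Rightarrow> real" where
  "q_mult \<epsilon> v1 v3 = max 0 (ddot \<epsilon> (tensor v1 v1 - tensor v3 v3)) / 2"

end

theory Submission
  imports Defs
begin

text \<open>Put \<open>D = v1 \<otimes> v1 - v3 \<otimes> v3\<close>. By the Rayleigh bounds, \<open>D : \<eta> \<le> \<lambda>\<^sub>1(\<eta>) - \<lambda>\<^sub>3(\<eta>)\<close> for every symmetric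
  \<open>\<eta>\<close>, with equality at \<open>\<sigma>\<close>, so the Tresca domain lies in the half-space \<open>D : (\<eta> - \<sigma>) \<le> 0\<close>. Conversely,
  the spectral gaps give \<open>\<lambda>\<^sub>1(\<sigma> + t\<tau>) - \<lambda>\<^sub>3(\<sigma> + t\<tau>) \<le> 2k + t D : \<tau> + O(t\<^sup>2)\<close>, so every direction with
  \<open>D : \<tau> < 0\<close> enters the domain. Hence the tangent cone is the half-space \<open>D : \<tau> \<le> 0\<close> and the normal
  cone is the ray spanned by \<open>D\<close>; the projections onto these are explicit because \<open>D : D = 2\<close>, and
  \<open>D : I = 0\<close> accounts for the elasticity operator and for the deviator.\<close>


section \<open>Spectral decomposition of symmetric matrices\<close>

lemma symmetric_inner_matrix_vector:
  fixes A :: "real^'n^'n"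
  assumes "transpose A = A"
  shows "x \<bullet> (A *v y) = (A *v x) \<bullet> y"
  by (metis assms dot_lmul_matrix transpose_matrix_vector)

text \<open>A maximizer of the Rayleigh quotient on the unit sphere is a critical point, hence an
  eigenvector. Working in an invariant subspace \<open>S\<close> allows repetition on complements of
  eigenvectors already found.\<close>

lemma max_Rayleigh_eigenvector:
  fixes A :: "real^'n^'n"
  assumes A: "transpose A = A" and S: "subspace S" "\<And>x. x \<in> S \<Longrightarrow> A *v x \<in> S"
    and z: "z \<in> S" "z \<noteq> 0"
  obtains e l where "e \<in> S" "norm e = 1" "A *v e = l *\<^sub>R e"
    "\<And>x. x \<in> S \<Longrightarrow> x \<bullet> (A *v x) \<le> l * (x \<bullet> x)"
proof -
  let ?K = "sphere 0 1 \<inter> S"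
  have "compact ?K"
    using S(1) by (simp add: closed_subspace compact_Int_closed)
  moreover have "(1 / norm z) *\<^sub>R z \<in> ?K"
    using z S(1) by (simp add: subspace_scale)
  then have "?K \<noteq> {}" by blast
  moreover have "continuous_on ?K (\<lambda>x. x \<bullet> (A *v x))"
    by (intro continuous_intros linear_continuous_on) (simp add: linear_linear)
  ultimately obtain e where e: "e \<in> ?K"
    and max: "\<And>x. x \<in> ?K \<Longrightarrow> x \<bullet> (A *v x) \<le> e \<bullet> (A *v e)"
    using continuous_attains_sup[of ?K "\<lambda>x. x \<bullet> (A *v x)"] by blast
  define l where "l = e \<bullet> (A *v e)"
  have ee: "e \<bullet> e = 1" "norm e = 1" "e \<in> S"
    using e by (auto simp: norm_eq_1)
  have bound: "x \<bullet> (A *v x) \<le> l * (x \<bullet> x)" if "x \<in> S" for x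
  proof (cases "x = 0")
    case False
    have "(1 / norm x) *\<^sub>R x \<in> ?K"
      using False S(1) that by (simp add: subspace_scale)
    from max[OF this] have "(x \<bullet> (A *v x)) / (norm x)\<^sup>2 \<le> l"
      by (simp add: l_def matrix_vector_mult_scaleR power2_eq_square)
    with False show ?thesis
      by (simp add: field_simps dot_square_norm)
  qed simp
  \<comment> \<open>First-order optimality at \<open>e\<close>, tested in the direction of the residual \<open>r\<close>.\<close>
  define r where "r = l *\<^sub>R e - A *v e"
  have rS: "r \<in> S"
    using S ee by (simp add: r_def subspace_diff subspace_scale)
  define c where "c = l * (r \<bullet> r) - r \<bullet> (A *v r)"
  \<comment> \<open>The bound is expanded at \<open>e - t *\<^sub>R r\<close>: constants cancel, and
    the definition of \<open>r\<close> turns the linear coefficient into minus twice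
    \<open>r \<bullet> r\<close>.\<close>
  have quad: "0 \<le> c * t\<^sup>2 - 2 * t * (r \<bullet> r)" for t
  proof -
    have "e - t *\<^sub>R r \<in> S"
      using S(1) ee rS by (simp add: subspace_diff subspace_scale)
    from bound[OF this]
    have "l - 2 * t * (r \<bullet> (A *v e)) + t\<^sup>2 * (r \<bullet> (A *v r)) 
        \<le> l * (1 - 2 * t * (r \<bullet> e) + t\<^sup>2 * (r \<bullet> r))"
      using symmetric_inner_matrix_vector[OF A, of e r] ee
      by (simp add: algebra_simps matrix_vector_mult_scaleR l_def[symmetric]
          power2_eq_square inner_commute)
    moreover have "r \<bullet> r = l * (r \<bullet> e) - r \<bullet> (A *v e)"
      by (simp add: r_def inner_diff_right)
    then have "r \<bullet> (A *v e) = l * (r \<bullet> e) - r \<bullet> r" by simp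
    ultimately show ?thesis
      by (simp add: c_def algebra_simps)
  qed
  have "r \<bullet> r = 0"
  proof (rule ccontr)
    assume "r \<bullet> r \<noteq> 0"
    then have pos: "0 < r \<bullet> r" by (simp only: inner_gt_zero_iff inner_eq_zero_iff simp_thms)
    \<comment> \<open>Small enough that the linear term of \<open>quad\<close> beats the quadratic
      one; the \<open>+ 1\<close> covers \<open>c = 0\<close>.\<close>
    define t where "t = (r \<bullet> r) / (\<bar>c\<bar> + 1)"
    have "0 < t" using pos by (simp add: t_def)
    have "c * t \<le> \<bar>c\<bar> * t" using \<open>0 < t\<close> by simp
    also have "\<dots> \<le> (\<bar>c\<bar> + 1) * t" using \<open>0 < t\<close> by simp
    also have "\<dots> = r \<bullet> r" by (simp add: t_def)
    finally have "c * t < 2 * (r \<bullet> r)" using pos by linarith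
    then have "t * (c * t - 2 * (r \<bullet> r)) < 0"
      using \<open>0 < t\<close> by (simp add: mult_less_0_iff)
    with quad[of t] show False
      by (simp add: algebra_simps power2_eq_square)
  qed
  then have "A *v e = l *\<^sub>R e" by (simp add: r_def)
  with that ee bound show ?thesis by blast
qed

lemma orthogonal_invariant_subspace:
  fixes A :: "real^'n^'n"
  assumes A: "transpose A = A" and e: "A *v e = l *\<^sub>R e" and x: "x \<bullet> e = 0"
  shows "(A *v x) \<bullet> e = 0"
  using symmetric_inner_matrix_vector[OF A, of x e] e x by simp

text \<open>Deflation: the Rayleigh quotient is maximized on the whole space, then on the complement
  of \<open>e1\<close>, then on that of \<open>e1\<close> and \<open>e2\<close>.\<close>

lemma symmetric_spectral_decomposition_3:
  fixes A :: "real^3^3"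
  assumes A: "transpose A = A"
  obtains P :: "real^3^3" and l :: "3 \<Rightarrow> real"
  where "orthogonal_matrix P" "\<forall>i. A *v row i P = l i *\<^sub>R row i P" "l 1 \<ge> l 2" "l 2 \<ge> l 3"
proof -
  note inv = orthogonal_invariant_subspace[OF A]
  obtain e1 l1 where 1: "norm e1 = 1" "A *v e1 = l1 *\<^sub>R e1"
    "\<And>x. x \<bullet> (A *v x) \<le> l1 * (x \<bullet> x)"
    using max_Rayleigh_eigenvector[OF A, of UNIV "axis 1 1"]
    by (auto simp: axis_eq_0_iff)
  \<comment> \<open>The dimension count provides the nonzero vector that the next maximization
    requires.\<close>
  have "dim {e1} < DIM(real^3)"
    using dim_le_card'[of "{e1}"] by simp
  then obtain z where z: "z \<noteq> 0" "z \<bullet> e1 = 0"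
    using orthogonal_to_subspace_exists[of "{e1}"] span_base
    unfolding orthogonal_def by (metis singletonI)
  have "subspace {x. x \<bullet> e1 = 0}"
    by (auto simp: subspace_def inner_simps)
  then obtain e2 l2 where 2: "norm e2 = 1" "e2 \<bullet> e1 = 0" "A *v e2 = l2 *\<^sub>R e2"
    "\<And>x. x \<bullet> e1 = 0 \<Longrightarrow> x \<bullet> (A *v x) \<le> l2 * (x \<bullet> x)"
    using max_Rayleigh_eigenvector[OF A, of "{x. x \<bullet> e1 = 0}" z] z inv[OF 1(2)]
    unfolding mem_Collect_eq by metis
  have "dim {e1, e2} < DIM(real^3)"
    using dim_le_card'[of "{e1, e2}"] by (simp add: card_insert_if split: if_splits)
  then obtain y where y: "y \<noteq> 0" "y \<bullet> e1 = 0" "y \<bullet> e2 = 0"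
    using orthogonal_to_subspace_exists[of "{e1, e2}"] span_base
    unfolding orthogonal_def by (metis insertCI)
  let ?S = "{x. x \<bullet> e1 = 0 \<and> x \<bullet> e2 = 0}"
  have S: "subspace ?S"
    by (auto simp: subspace_def inner_simps)
  have S': "A *v x \<in> ?S" if "x \<in> ?S" for x
    using inv[OF 1(2), of x] inv[OF 2(3), of x] that by simp
  have "y \<in> ?S" using y by simp
  from max_Rayleigh_eigenvector[OF A S S' this y(1)]
  obtain e3 l3 where "e3 \<in> ?S" "norm e3 = 1" "A *v e3 = l3 *\<^sub>R e3" .
  then have 3: "norm e3 = 1" "e3 \<bullet> e1 = 0" "e3 \<bullet> e2 = 0" "A *v e3 = l3 *\<^sub>R e3"
    by simp_all
  have unit: "e1 \<bullet> e1 = 1" "e2 \<bullet> e2 = 1" "e3 \<bullet> e3 = 1"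
    using 1 2 3 by (auto simp: norm_eq_1)
  define P :: "real^3^3" where "P = vector [e1, e2, e3]"
  define l :: "3 \<Rightarrow> real" where "l = (\<lambda>i. if i = 1 then l1 else if i = 2 then l2 else l3)"
  have rows: "row 1 P = e1" "row 2 P = e2" "row 3 P = e3"
    by (simp_all add: P_def row_def)
  have "orthogonal_matrix P"
    unfolding orthogonal_matrix_orthonormal_rows orthogonal_def forall_3 rows
    using 1 2 3 by (auto simp: inner_commute)
  moreover have "\<forall>i. A *v row i P = l i *\<^sub>R row i P"
    using rows 1(2) 2(3) 3(4) by (auto simp: l_def forall_3)
  \<comment> \<open>Each eigenvector is tested in the Rayleigh bound of the preceding stage.\<close>
  moreover have "l 1 \<ge> l 2" "l 2 \<ge> l 3"
    using 1(3)[of e2] 2(4)[of e3] 2(3) 3(2,4) unit by (auto simp: l_def)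
  ultimately show ?thesis by (rule that)
qed

text \<open>Parseval's identity in the orthonormal basis formed by the rows of
  \<open>P\<close>.\<close>

lemma orthogonal_matrix_inner_rows:
  fixes P :: "real^'n^'n"
  assumes "orthogonal_matrix P"
  shows "x \<bullet> y = (\<Sum>i\<in>UNIV. (row i P \<bullet> x) * (row i P \<bullet> y))"
proof -
  have "(P *v x) \<bullet> (P *v y) = x \<bullet> (transpose P *v (P *v y))"
    by (simp add: inner_commute[of x] dot_lmul_matrix inner_commute[of "P *v y"])
  also have "\<dots> = x \<bullet> y"
    using assms by (simp add: matrix_vector_mul_assoc orthogonal_matrix_def)
  finally show ?thesis
    by (simp add: inner_vec_def[of "P *v x"] matrix_vector_mul_component row_def vec_lambda_eta)
qed

section \<open>Ordered eigenvalues read off an eigenbasis\<close>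

text \<open>The eigenvector equations amount to
  \<open>(mat t - A) ** transpose P = transpose P ** D\<close> with \<open>D\<close> diagonal.
  Taking determinants and cancelling \<open>det P\<close> gives equality at every real
  \<open>t\<close>, hence of polynomials.\<close>

lemma charpoly_diagonalized:
  fixes A P :: "real^'n^'n"
  assumes P: "orthogonal_matrix P" and l: "\<forall>i. A *v row i P = l i *\<^sub>R row i P"
  shows "charpoly A = (\<Prod>i\<in>UNIV. [:- l i, 1:])"
proof -
  have "poly (charpoly A) t = poly (\<Prod>i\<in>UNIV. [:- l i, 1:]) t" for t
  proof -
    define D :: "real^'n^'n" where "D = (\<chi> i j. if i = j then t - l i else 0)"
    have "((mat t - A) ** transpose P) $ i $ j = (transpose P ** D) $ i $ j" for i j
    proof -
      have "mat t *v x = t *\<^sub>R x" for x :: "real^'n"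
        by (simp add: vec_eq_iff mat_def matrix_vector_mult_def if_distrib[of "\<lambda>x. x * _"] cong: if_cong)
      then have "(mat t - A) *v row j P = (t - l j) *\<^sub>R row j P"
        by (simp add: matrix_vector_mult_diff_rdistrib l scaleR_left_diff_distrib)
      moreover have "((mat t - A) ** transpose P) $ i $ j = ((mat t - A) *v row j P) $ i"
        by (simp add: matrix_matrix_mult_def matrix_vector_mult_def transpose_def row_def)
      moreover have "(transpose P ** D) $ i $ j = (t - l j) * row j P $ i"
        by (simp add: D_def matrix_matrix_mult_def transpose_def row_def if_distrib cong: if_cong)
      ultimately show ?thesis by simp
    qed
    then have "(mat t - A) ** transpose P = transpose P ** D"
      by (simp add: vec_eq_iff)
    then have "det (mat t - A) * det (transpose P) = det (transpose P) * det D"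
      by (metis det_mul)
    moreover have "det P \<noteq> 0"
      using det_orthogonal_matrix[OF P] by auto
    ultimately have "det (mat t - A) = det D" by simp
    also have "det D = (\<Prod>i\<in>UNIV. t - l i)"
      by (subst det_diagonal) (auto simp: D_def)
    finally show ?thesis by (simp add: poly_charpoly poly_prod)
  qed
  then show ?thesis by (simp add: poly_eq_poly_eq_iff[symmetric] fun_eq_iff)
qed

lemma eigval_diagonalized_3:
  fixes A P :: "real^3^3"
  assumes "orthogonal_matrix P" and "\<forall>i. A *v row i P = l i *\<^sub>R row i P"
    and "l 1 \<ge> l 2" "l 2 \<ge> l 3"
  shows "eigval A 1 = l 1" "eigval A 2 = l 2" "eigval A 3 = l 3"
proof -
  have "proots (charpoly A) = (\<Sum>i\<in>UNIV. {#l i#})"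
    by (simp add: charpoly_diagonalized[OF assms(1,2)] proots_prod)
  \<comment> \<open>The list is ascending because \<open>eigval\<close> reverses the sorted list of
    roots.\<close>
  then have "proots (charpoly A) = mset [l 3, l 2, l 1]"
    by (simp add: sum_3)
  then have "sorted_list_of_multiset (proots (charpoly A)) = sort [l 3, l 2, l 1]"
    by (simp only: sorted_list_of_multiset_mset)
  also have "\<dots> = [l 3, l 2, l 1]"
    using assms(3,4) by (intro sorted_sort_id) simp
  finally show "eigval A 1 = l 1" "eigval A 2 = l 2" "eigval A 3 = l 3"
    by (simp_all add: eigval_def)
qed

text \<open>Packages eigenbasis and \<open>eigval\<close> together, so that the characteristic
  polynomial is no longer needed below.\<close>

lemma eigval_decomposition_3:
  fixes A :: "real^3^3"
  assumes A: "transpose A = A"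
  shows "\<exists>(P :: real^3^3) l. orthogonal_matrix P \<and> (\<forall>i. A *v row i P = l i *\<^sub>R row i P)
    \<and> l 1 \<ge> l 2 \<and> l 2 \<ge> l 3 \<and> eigval A 1 = l 1 \<and> eigval A 2 = l 2 \<and> eigval A 3 = l 3"
proof -
  obtain P :: "real^3^3" and l
    where P: "orthogonal_matrix P" "\<forall>i. A *v row i P = l i *\<^sub>R row i P" "l 1 \<ge> l 2" "l 2 \<ge> l 3"
    using symmetric_spectral_decomposition_3[OF A] by blast
  with eigval_diagonalized_3[OF P] show ?thesis by blast
qed

section \<open>Rayleigh bounds and spectral gaps\<close>

lemma quadratic_form_diagonalized:
  fixes A P :: "real^'n^'n"
  assumes P: "orthogonal_matrix P" and l: "\<forall>i. A *v row i P = l i *\<^sub>R row i P"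
    and A: "transpose A = A"
  shows "x \<bullet> (A *v x) = (\<Sum>i\<in>UNIV. l i * (row i P \<bullet> x)\<^sup>2)"
proof -
  have "row i P \<bullet> (A *v x) = l i * (row i P \<bullet> x)" for i
    by (simp add: symmetric_inner_matrix_vector[OF A] l)
  then show ?thesis
    by (simp add: orthogonal_matrix_inner_rows[OF P, of x] power2_eq_square ac_simps)
qed

lemma Rayleigh_eigval_3:
  fixes A :: "real^3^3"
  assumes A: "transpose A = A"
  shows "x \<bullet> (A *v x) \<le> eigval A 1 * (x \<bullet> x)" "eigval A 3 * (x \<bullet> x) \<le> x \<bullet> (A *v x)"
proof -
  obtain P l where P: "orthogonal_matrix P" "\<forall>i. A *v row i P = l i *\<^sub>R row i P"
    and l: "l 1 \<ge> l 2" "l 2 \<ge> l 3" "eigval A 1 = l 1" "eigval A 3 = l 3"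
    using eigval_decomposition_3[OF A] by blast
  have *: "x \<bullet> (A *v x) = (\<Sum>i\<in>UNIV. l i * (row i P \<bullet> x)\<^sup>2)"
    "x \<bullet> x = (\<Sum>i\<in>UNIV. (row i P \<bullet> x)\<^sup>2)"
    using quadratic_form_diagonalized[OF P A] orthogonal_matrix_inner_rows[OF P(1), of x x]
    by (simp_all add: power2_eq_square)
  have b: "l i \<le> l 1" "l 3 \<le> l i" for i
    using l exhaust_3[of i] by auto
  show "x \<bullet> (A *v x) \<le> eigval A 1 * (x \<bullet> x)" "eigval A 3 * (x \<bullet> x) \<le> x \<bullet> (A *v x)"
    unfolding * l sum_distrib_left using b by (intro sum_mono mult_right_mono; simp)+
qed

text \<open>Serves to turn bounds uniform over unit vectors into bounds on the extreme
  eigenvalues.\<close>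

lemma eigval_attained_3:
  fixes A :: "real^3^3"
  assumes A: "transpose A = A"
  obtains x y where "x \<bullet> x = 1" "x \<bullet> (A *v x) = eigval A 1"
    "y \<bullet> y = 1" "y \<bullet> (A *v y) = eigval A 3"
proof -
  obtain P l where P: "orthogonal_matrix P" "\<forall>i. A *v row i P = l i *\<^sub>R row i P"
    and l: "eigval A 1 = l 1" "eigval A 3 = l 3"
    using eigval_decomposition_3[OF A] by blast
  have "row i P \<bullet> row i P = 1" for i
    using P(1) by (simp add: orthogonal_matrix_orthonormal_rows norm_eq_1)
  then show ?thesis
    using that[of "row 1 P" "row 3 P"] by (simp add: P(2) l del: One_nat_def)
qed

text \<open>A strict gap makes the extreme eigenspace a line, so orthogonality to the given
  \<open>v\<close> is orthogonality to the corresponding row of \<open>P\<close>. Only terms on one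
  side of the middle eigenvalue remain.\<close>

lemma eigval_gap_3:
  fixes A :: "real^3^3"
  assumes A: "transpose A = A"
  shows "\<lbrakk>eigval A 1 > eigval A 2; A *v v = eigval A 1 *\<^sub>R v; norm v = 1; w \<bullet> v = 0\<rbrakk>
      \<Longrightarrow> w \<bullet> (A *v w) \<le> eigval A 2 * (w \<bullet> w)"
    and "\<lbrakk>eigval A 2 > eigval A 3; A *v v = eigval A 3 *\<^sub>R v; norm v = 1; w \<bullet> v = 0\<rbrakk>
      \<Longrightarrow> w \<bullet> (A *v w) \<ge> eigval A 2 * (w \<bullet> w)"
proof -
  obtain P l where P: "orthogonal_matrix P" "\<forall>i. A *v row i P = l i *\<^sub>R row i P"
    and l: "l 1 \<ge> l 2" "l 2 \<ge> l 3"
    and eig: "eigval A 1 = l 1" "eigval A 2 = l 2" "eigval A 3 = l 3"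
    using eigval_decomposition_3[OF A] by blast
  have *: "x \<bullet> (A *v x) = (\<Sum>i\<in>UNIV. l i * (row i P \<bullet> x)\<^sup>2)"
    "x \<bullet> y = (\<Sum>i\<in>UNIV. (row i P \<bullet> x) * (row i P \<bullet> y))" for x y
    using quadratic_form_diagonalized[OF P A] orthogonal_matrix_inner_rows[OF P(1), of x y]
    by simp_all
  \<comment> \<open>Eigenvectors for different eigenvalues are orthogonal, so the unit vector
    \<open>v\<close> is a nonzero multiple of \<open>row j P\<close>.\<close>
  have perp: "row j P \<bullet> w = 0"
    if v: "A *v v = l j *\<^sub>R v" "norm v = 1" "w \<bullet> v = 0" and j: "\<And>i. i \<noteq> j \<Longrightarrow> l i \<noteq> l j" for j v w
  proof -
    have 0: "row i P \<bullet> v = 0" if "i \<noteq> j" for i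
    proof -
      have "l i * (row i P \<bullet> v) = l j * (row i P \<bullet> v)"
        using symmetric_inner_matrix_vector[OF A, of "row i P" v] by (auto simp: P(2) v(1))
      with j[OF that] show ?thesis by simp
    qed
    have sum: "(\<Sum>i\<in>UNIV. f i * (row i P \<bullet> v)) = f j * (row j P \<bullet> v)" for f :: "3 \<Rightarrow> real"
      by (subst sum.remove[of _ j]) (auto simp: 0)
    have "v \<bullet> v = 1" using v(2) by (simp add: norm_eq_1)
    then have "row j P \<bullet> v \<noteq> 0"
      using *(2)[of v v] sum[of "\<lambda>i. row i P \<bullet> v"] by auto
    moreover have "(row j P \<bullet> w) * (row j P \<bullet> v) = 0"
      using *(2)[of w v] sum[of "\<lambda>i. row i P \<bullet> w"] v(3) by simp
    ultimately show ?thesis by simp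
  qed
  { assume h: "eigval A 1 > eigval A 2" "A *v v = eigval A 1 *\<^sub>R v" "norm v = 1" "w \<bullet> v = 0"
    have "l i \<noteq> l 1" if "i \<noteq> 1" for i
      using exhaust_3[of i] that h(1) l eig by auto
    with h eig have "row 1 P \<bullet> w = 0" by (intro perp[of v 1 w]) simp_all
    then show "w \<bullet> (A *v w) \<le> eigval A 2 * (w \<bullet> w)"
      using l(2) by (simp add: *(1)[of w] *(2)[of w w] sum_3 eig distrib_left power2_eq_square mult_right_mono) }
  { assume h: "eigval A 2 > eigval A 3" "A *v v = eigval A 3 *\<^sub>R v" "norm v = 1" "w \<bullet> v = 0"
    have "l i \<noteq> l 3" if "i \<noteq> 3" for i
      using exhaust_3[of i] that h(1) l eig by auto
    with h eig have "row 3 P \<bullet> w = 0" by (intro perp[of v 3 w]) simp_all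
    then show "w \<bullet> (A *v w) \<ge> eigval A 2 * (w \<bullet> w)"
      using l(1) by (simp add: *(1)[of w] *(2)[of w w] sum_3 eig distrib_left power2_eq_square mult_right_mono) }
qed


section \<open>Second-order perturbation of a simple extreme eigenvalue\<close>

text \<open>Split \<open>x\<close> into a multiple of \<open>v\<close> and an orthogonal part
  \<open>w\<close>. The gap costs the form of \<open>A\<close> at least \<open>g\<close> times the
  squared norm of \<open>w\<close>, while the first-order gain from \<open>B\<close> is at most of
  order \<open>t\<close> times the norm of \<open>w\<close>, plus a quadratic term. The balance is
  of order \<open>t\<^sup>2\<close>, uniformly in \<open>x\<close>.\<close>

lemma quadratic_form_perturbation:
  fixes A B :: "real^'n^'n"
  assumes A: "transpose A = A" and v: "norm v = 1" "A *v v = l *\<^sub>R v" and g: "g > 0"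
    and gap: "\<And>w. w \<bullet> v = 0 \<Longrightarrow> w \<bullet> (A *v w) \<le> (l - g) * (w \<bullet> w)"
  obtains K d where "d > 0"
    "\<And>t x. \<lbrakk>0 < t; t < d; x \<bullet> x = 1\<rbrakk>
      \<Longrightarrow> x \<bullet> ((A + t *\<^sub>R B) *v x) \<le> l + t * (v \<bullet> (B *v v)) + K * t\<^sup>2"
proof -
  have "bounded_linear ((*v) B)"
    by (simp add: linear_linear)
  then obtain M where M: "M > 0" "\<And>x. norm (B *v x) \<le> norm x * M"
    using bounded_linear.pos_bounded by blast
  have B: "\<bar>x \<bullet> (B *v y)\<bar> \<le> M * (norm x * norm y)" for x y
  proof -
    have "\<bar>x \<bullet> (B *v y)\<bar> \<le> norm x * norm (B *v y)" by (rule Cauchy_Schwarz_ineq2)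
    also have "\<dots> \<le> norm x * (norm y * M)" by (intro mult_left_mono M) simp
    finally show ?thesis by (simp add: ac_simps)
  qed
  have vv: "v \<bullet> v = 1" using v by (simp add: norm_eq_1)
  show ?thesis
  \<comment> \<open>The range of \<open>t\<close> lets half of the loss \<open>g * n\<^sup>2\<close>
    absorb \<open>2 * t * M * n\<^sup>2\<close>; completing the square with the other half leaves
    the constant \<open>2 * M\<^sup>2 / g\<close>.\<close>
  proof (rule that[of "g / (4 * M)" "2 * M\<^sup>2 / g"])
    show "g / (4 * M) > 0" using g M by simp
    fix t :: real and x :: "real^'n"
    assume t: "0 < t" "t < g / (4 * M)" and x: "x \<bullet> x = 1"
    define a where "a = x \<bullet> v"
    define w where "w = x - a *\<^sub>R v"
    define n where "n = norm w"
    have wv: "w \<bullet> v = 0" by (simp add: w_def a_def inner_diff_left vv)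
    have xw: "x = a *\<^sub>R v + w" by (simp add: w_def)
    have n2: "n\<^sup>2 = w \<bullet> w" by (simp add: n_def dot_square_norm)
    have a2: "a\<^sup>2 = 1 - n\<^sup>2"
      using x wv by (simp add: xw inner_simps n2 inner_commute[of v w] vv power2_eq_square[of a])
    have "a\<^sup>2 \<le> 1" by (simp add: a2)
    then have a1: "\<bar>a\<bar> \<le> 1" using abs_square_le_1 by blast
    have "n \<ge> 0" by (simp add: n_def)
    \<comment> \<open>The cross terms of the form of \<open>A\<close> vanish because
      \<open>v\<close> is an eigenvector and \<open>A\<close> is symmetric.\<close>
    have "w \<bullet> (A *v v) = 0" "v \<bullet> (A *v w) = 0"
      using wv symmetric_inner_matrix_vector[OF A, of v w] by (simp_all add: v inner_commute)
    then have "x \<bullet> (A *v x) = a\<^sup>2 * l + w \<bullet> (A *v w)"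
      by (simp add: xw inner_simps matrix_vector_mult_scaleR matrix_vector_right_distrib v vv
          power2_eq_square)
    then have Ax: "x \<bullet> (A *v x) \<le> l - g * n\<^sup>2"
      using gap[OF wv] by (simp add: a2 n2 algebra_simps)
    have "x \<bullet> (B *v x) = a\<^sup>2 * (v \<bullet> (B *v v)) + a * (v \<bullet> (B *v w) + w \<bullet> (B *v v)) + w \<bullet> (B *v w)"
      by (simp add: xw inner_simps matrix_vector_mult_scaleR matrix_vector_right_distrib
          power2_eq_square algebra_simps)
    then have "x \<bullet> (B *v x) - v \<bullet> (B *v v)
      = - n\<^sup>2 * (v \<bullet> (B *v v)) + a * (v \<bullet> (B *v w) + w \<bullet> (B *v v)) + w \<bullet> (B *v w)"
      by (simp add: a2 algebra_simps)
    also have "\<dots> \<le> n\<^sup>2 * M + 2 * M * n + M * n\<^sup>2"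
    proof (intro add_mono)
      show "- n\<^sup>2 * (v \<bullet> (B *v v)) \<le> n\<^sup>2 * M"
        using B[of v v] v(1) mult_left_mono[of "- (v \<bullet> (B *v v))" M "n\<^sup>2"] by simp
      have "\<bar>v \<bullet> (B *v w) + w \<bullet> (B *v v)\<bar> \<le> 2 * M * n"
        using B[of v w] B[of w v] v(1) by (simp add: n_def)
      then have "\<bar>a\<bar> * \<bar>v \<bullet> (B *v w) + w \<bullet> (B *v v)\<bar> \<le> 1 * (2 * M * n)"
        using a1 by (intro mult_mono) auto
      then show "a * (v \<bullet> (B *v w) + w \<bullet> (B *v v)) \<le> 2 * M * n"
        by (simp add: abs_mult[symmetric])
      show "w \<bullet> (B *v w) \<le> M * n\<^sup>2"
        using B[of w w] by (simp add: n_def power2_eq_square)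
    qed
    finally have "t * (x \<bullet> (B *v x) - v \<bullet> (B *v v)) \<le> t * (2 * M * n\<^sup>2 + 2 * M * n)"
      using t(1) by (intro mult_left_mono) auto
    then have Bx: "t * (x \<bullet> (B *v x)) \<le> t * (v \<bullet> (B *v v)) + 2 * t * M * n\<^sup>2 + 2 * t * M * n"
      by (simp add: algebra_simps)
    have "t * M * 4 \<le> g"
      using t M by (simp add: field_simps)
    then have "(t * M * 4) * n\<^sup>2 \<le> g * n\<^sup>2"
      by (intro mult_right_mono) auto
    moreover have "(g / 2) * (n - 2 * t * M / g)\<^sup>2 = g / 2 * n\<^sup>2 - 2 * t * M * n + 2 * M\<^sup>2 / g * t\<^sup>2"
      using g by (simp add: power2_eq_square field_simps)
    moreover have "0 \<le> (g / 2) * (n - 2 * t * M / g)\<^sup>2"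
      using g by simp
    ultimately have "- g * n\<^sup>2 + 2 * t * M * n\<^sup>2 + 2 * t * M * n \<le> 2 * M\<^sup>2 / g * t\<^sup>2"
      by (simp add: algebra_simps)
    with Ax Bx show "x \<bullet> ((A + t *\<^sub>R B) *v x) \<le> l + t * (v \<bullet> (B *v v)) + 2 * M\<^sup>2 / g * t\<^sup>2"
      by (simp add: matrix_vector_mult_add_rdistrib scaleR_matrix_vector_assoc[symmetric] inner_add_right)
  qed
qed

section \<open>Tangent and normal cones of the Tresca domain at a simple spectrum\<close>

lemma inner_tensor: "tensor x x \<bullet> A = x \<bullet> (A *v x)"
  by (simp add: tensor_def inner_vec_def matrix_vector_mult_def sum_distrib_left ac_simps)

lemma subspace_sym_mats: "subspace sym_mats"
  by (auto simp: subspace_def sym_mats_def transpose_def vec_eq_iff)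

lemma tensor_in_sym_mats: "tensor x x \<in> sym_mats"
  by (simp add: tensor_def sym_mats_def transpose_def vec_eq_iff)

lemma mat_1_in_sym_mats: "mat 1 \<in> sym_mats"
  by (simp add: sym_mats_def transpose_mat)

text \<open>The yield bound is not a parameter: writing it as \<open>f_T \<sigma>\<close> places
  \<open>\<sigma>\<close> on the yield surface by construction.\<close>

locale simple_spectrum =
  fixes \<sigma> :: "real^3^3" and v1 v3 :: "real^3"
  assumes sym: "\<sigma> \<in> sym_mats"
    and gap12: "eigval \<sigma> 1 > eigval \<sigma> 2" and gap23: "eigval \<sigma> 2 > eigval \<sigma> 3"
    and v1: "norm v1 = 1" "\<sigma> *v v1 = eigval \<sigma> 1 *\<^sub>R v1"
    and v3: "norm v3 = 1" "\<sigma> *v v3 = eigval \<sigma> 3 *\<^sub>R v3"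
begin

text \<open>The gradient of the difference of extreme eigenvalues at \<open>\<sigma>\<close>, that
  is, an outer normal of the yield surface.\<close>

definition D where "D = tensor v1 v1 - tensor v3 v3"

lemma transpose: "transpose \<sigma> = \<sigma>"
  using sym by (simp add: sym_mats_def)

lemma D_sym: "D \<in> sym_mats"
  unfolding D_def by (intro subspace_diff subspace_sym_mats tensor_in_sym_mats)

lemma inner_D: "D \<bullet> A = v1 \<bullet> (A *v v1) - v3 \<bullet> (A *v v3)"
  by (simp add: D_def inner_diff_left inner_tensor)

lemma unit: "v1 \<bullet> v1 = 1" "v3 \<bullet> v3 = 1"
  using v1 v3 by (simp_all add: norm_eq_1)

text \<open>Orthogonality of \<open>v1\<close> and \<open>v3\<close> removes the cross terms, and
  each dyad contributes 1. This is the origin of the factor one half in the multiplier.\<close>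

lemma D_norm: "D \<bullet> D = 2"
proof -
  have "eigval \<sigma> 3 * (v1 \<bullet> v3) = eigval \<sigma> 1 * (v1 \<bullet> v3)"
    using symmetric_inner_matrix_vector[OF transpose, of v1 v3] by (simp add: v1 v3 del: One_nat_def)
  then have "v1 \<bullet> v3 = 0" using gap12 gap23 by auto
  moreover have "tensor x x *v y = (x \<bullet> y) *\<^sub>R x" for x y
    by (simp add: tensor_def vec_eq_iff matrix_vector_mult_def inner_vec_def sum_distrib_left ac_simps)
  ultimately show ?thesis
    by (simp add: inner_D) (simp add: D_def matrix_vector_mult_diff_rdistrib unit inner_diff_right inner_commute[of v3 v1])
qed

lemma D_identity: "D \<bullet> mat 1 = 0"
  by (simp add: inner_D unit)

lemma tresca_half_space:
  assumes "\<eta> \<in> tresca (f_T \<sigma>)"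
  shows "D \<bullet> (\<eta> - \<sigma>) \<le> 0"
proof -
  have \<eta>: "transpose \<eta> = \<eta>" "eigval \<eta> 1 - eigval \<eta> 3 \<le> eigval \<sigma> 1 - eigval \<sigma> 3"
    using assms by (auto simp: tresca_def sym_mats_def f_T_def)
  have "D \<bullet> \<eta> \<le> eigval \<eta> 1 - eigval \<eta> 3"
    using Rayleigh_eigval_3(1)[OF \<eta>(1), of v1] Rayleigh_eigval_3(2)[OF \<eta>(1), of v3]
    by (simp add: inner_D unit)
  moreover have "D \<bullet> \<sigma> = eigval \<sigma> 1 - eigval \<sigma> 3"
    by (simp add: inner_D v1 v3 unit)
  ultimately show ?thesis using \<eta>(2) by (simp add: inner_diff_right)
qed

text \<open>The perturbation bounds for both extreme eigenvalues add up to the first-order term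
  \<open>t * (D \<bullet> \<tau>)\<close>, whose strict negativity absorbs the quadratic remainder
  for small \<open>t\<close>.\<close>

lemma tresca_interior_direction:
  assumes \<tau>: "\<tau> \<in> sym_mats" "D \<bullet> \<tau> < 0"
  obtains t where "t > 0" "\<sigma> + t *\<^sub>R \<tau> \<in> tresca (f_T \<sigma>)"
proof -
  obtain K1 d1 where 1: "d1 > 0" "\<And>t x. \<lbrakk>0 < t; t < d1; x \<bullet> x = 1\<rbrakk>
      \<Longrightarrow> x \<bullet> ((\<sigma> + t *\<^sub>R \<tau>) *v x) \<le> eigval \<sigma> 1 + t * (v1 \<bullet> (\<tau> *v v1)) + K1 * t\<^sup>2"
  proof (rule quadratic_form_perturbation[OF transpose v1, of "eigval \<sigma> 1 - eigval \<sigma> 2" \<tau>])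
    show "w \<bullet> (\<sigma> *v w) \<le> (eigval \<sigma> 1 - (eigval \<sigma> 1 - eigval \<sigma> 2)) * (w \<bullet> w)"
      if "w \<bullet> v1 = 0" for w
      using eigval_gap_3(1)[OF transpose gap12 v1(2,1) that] by simp
  qed (use gap12 in auto)
  have neg: "(- A) *v x = - (A *v x)" for A :: "real^3^3" and x
    using matrix_vector_mult_diff_rdistrib[of 0 A x] by simp
  \<comment> \<open>The smallest eigenvalue is handled as the largest one of
    \<open>- \<sigma>\<close>, whose gap is
    \<open>eigval \<sigma> 2 - eigval \<sigma> 3\<close>.\<close>
  obtain K3 d3 where 3: "d3 > 0" "\<And>t x. \<lbrakk>0 < t; t < d3; x \<bullet> x = 1\<rbrakk>
      \<Longrightarrow> x \<bullet> ((- \<sigma> + t *\<^sub>R (- \<tau>)) *v x) \<le> - eigval \<sigma> 3 + t * (v3 \<bullet> ((- \<tau>) *v v3)) + K3 * t\<^sup>2"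
  proof (rule quadratic_form_perturbation[of "- \<sigma>" v3 "- eigval \<sigma> 3" "eigval \<sigma> 2 - eigval \<sigma> 3" "- \<tau>"])
    show "transpose (- \<sigma>) = - \<sigma>"
      using subspace_neg[OF subspace_sym_mats sym] by (simp add: sym_mats_def)
    show "w \<bullet> ((- \<sigma>) *v w) \<le> (- eigval \<sigma> 3 - (eigval \<sigma> 2 - eigval \<sigma> 3)) * (w \<bullet> w)"
      if "w \<bullet> v3 = 0" for w
      using eigval_gap_3(2)[OF transpose gap23 v3(2,1) that] by (simp add: neg)
  qed (use gap23 v3 in \<open>auto simp: neg\<close>)
  \<comment> \<open>Halving keeps \<open>t\<close> strictly inside both ranges; the second entry
    yields \<open>(K1 + K3) * t \<le> - (D \<bullet> \<tau>)\<close>.\<close>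
  define t where "t = min (min d1 d3 / 2) (- (D \<bullet> \<tau>) / (\<bar>K1 + K3\<bar> + 1))"
  have t: "0 < t" "t < d1" "t < d3"
    using 1(1) 3(1) \<tau>(2) by (auto simp: t_def divide_less_0_iff)
  have "t \<le> - (D \<bullet> \<tau>) / (\<bar>K1 + K3\<bar> + 1)" by (simp add: t_def)
  then have "t * (\<bar>K1 + K3\<bar> + 1) \<le> - (D \<bullet> \<tau>)"
    by (simp add: field_simps)
  moreover have "t * (K1 + K3) \<le> t * (\<bar>K1 + K3\<bar> + 1)"
    using t(1) by (intro mult_left_mono) auto
  ultimately have "D \<bullet> \<tau> + (K1 + K3) * t \<le> 0" by (simp add: mult.commute)
  then have "t * (D \<bullet> \<tau> + (K1 + K3) * t) \<le> 0"
    using t(1) by (simp add: mult_le_0_iff)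
  then have small: "t * (D \<bullet> \<tau>) + K1 * t\<^sup>2 + K3 * t\<^sup>2 \<le> 0"
    by (simp add: algebra_simps power2_eq_square)
  let ?A = "\<sigma> + t *\<^sub>R \<tau>"
  have A: "?A \<in> sym_mats"
    by (intro subspace_add subspace_scale subspace_sym_mats sym \<tau>)
  then have "transpose ?A = ?A" by (simp add: sym_mats_def)
  then obtain x y where x: "x \<bullet> x = 1" "x \<bullet> (?A *v x) = eigval ?A 1"
    and y: "y \<bullet> y = 1" "y \<bullet> (?A *v y) = eigval ?A 3"
    by (rule eigval_attained_3)
  have "eigval ?A 1 \<le> eigval \<sigma> 1 + t * (v1 \<bullet> (\<tau> *v v1)) + K1 * t\<^sup>2"
    using 1(2)[OF t(1,2) x(1)] x(2) by simp
  moreover have "- ?A = - \<sigma> + t *\<^sub>R (- \<tau>)" by simp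
  then have "- eigval ?A 3 \<le> - eigval \<sigma> 3 + t * (v3 \<bullet> ((- \<tau>) *v v3)) + K3 * t\<^sup>2"
    using 3(2)[OF t(1,3) y(1)] y(2) by (metis neg inner_minus_right)
  then have "- eigval ?A 3 \<le> - eigval \<sigma> 3 - t * (v3 \<bullet> (\<tau> *v v3)) + K3 * t\<^sup>2"
    by (simp add: neg)
  ultimately have "eigval ?A 1 - eigval ?A 3 \<le> eigval \<sigma> 1 - eigval \<sigma> 3"
    using small by (simp add: inner_D right_diff_distrib del: One_nat_def)
  with A have "?A \<in> tresca (f_T \<sigma>)" by (simp add: tresca_def f_T_def)
  with t(1) that show ?thesis by blast
qed

text \<open>The closed half-space contains all admissible directions; conversely, strictly inward
  directions are admissible and dense in it.\<close>

lemma tangent_cone_tresca: "tangent_cone (tresca (f_T \<sigma>)) \<sigma> = {\<tau> \<in> sym_mats. D \<bullet> \<tau> \<le> 0}"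
proof
  have closed: "closed {\<tau> \<in> sym_mats. D \<bullet> \<tau> \<le> 0}"
    using closed_Int[OF closed_subspace[OF subspace_sym_mats] closed_halfspace_le[of D 0]]
    by (simp add: Int_def)
  have "\<alpha> *\<^sub>R (\<eta> - \<sigma>) \<in> {\<tau> \<in> sym_mats. D \<bullet> \<tau> \<le> 0}"
    if "\<eta> \<in> tresca (f_T \<sigma>)" "\<alpha> > 0" for \<alpha> \<eta>
  proof -
    have "\<alpha> *\<^sub>R (\<eta> - \<sigma>) \<in> sym_mats"
      using that(1) by (intro subspace_scale subspace_diff subspace_sym_mats sym) (simp add: tresca_def)
    with tresca_half_space[OF that(1)] that(2) show ?thesis by (simp add: mult_le_0_iff)
  qed
  then show "tangent_cone (tresca (f_T \<sigma>)) \<sigma> \<subseteq> {\<tau> \<in> sym_mats. D \<bullet> \<tau> \<le> 0}"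
    unfolding tangent_cone_def by (intro closure_minimal closed) blast
  show "{\<tau> \<in> sym_mats. D \<bullet> \<tau> \<le> 0} \<subseteq> tangent_cone (tresca (f_T \<sigma>)) \<sigma>"
  proof
    fix \<tau> assume "\<tau> \<in> {\<tau> \<in> sym_mats. D \<bullet> \<tau> \<le> 0}"
    then have \<tau>: "\<tau> \<in> sym_mats" "D \<bullet> \<tau> \<le> 0" by auto
    show "\<tau> \<in> tangent_cone (tresca (f_T \<sigma>)) \<sigma>"
      unfolding tangent_cone_def closure_approachable
    proof (intro allI impI)
      fix e :: real assume "e > 0"
      \<comment> \<open>Boundary directions \<open>D : \<tau> = 0\<close> need not be admissible, so push \<open>\<tau>\<close> slightly inwards.\<close>
      define s where "s = e / (norm D + 1)"
      have s: "s > 0" using \<open>e > 0\<close> by (simp add: s_def add_nonneg_pos)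
      have "s * norm D < s * (norm D + 1)" using s by simp
      also have "\<dots> = e" using norm_ge_zero[of D] by (simp add: s_def del: norm_ge_zero)
      finally have small: "s * norm D < e" .
      let ?y = "\<tau> - s *\<^sub>R D"
      have y: "?y \<in> sym_mats"
        by (intro subspace_diff subspace_scale subspace_sym_mats \<tau> D_sym)
      have "D \<bullet> ?y < 0" using \<tau>(2) s by (simp add: inner_diff_right D_norm)
      with y obtain t where t: "t > 0" "\<sigma> + t *\<^sub>R ?y \<in> tresca (f_T \<sigma>)"
        by (rule tresca_interior_direction)
      have "?y = (1 / t) *\<^sub>R ((\<sigma> + t *\<^sub>R ?y) - \<sigma>)" "1 / t > 0" using t(1) by simp_all
      with t(2) have "?y \<in> {\<alpha> *\<^sub>R (\<eta> - \<sigma>) |\<alpha> \<eta>. \<eta> \<in> tresca (f_T \<sigma>) \<and> \<alpha> > 0}" by blast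
      moreover have "dist ?y \<tau> < e" using s small by (simp add: dist_norm)
      ultimately show "\<exists>y\<in>{\<alpha> *\<^sub>R (\<eta> - \<sigma>) |\<alpha> \<eta>. \<eta> \<in> tresca (f_T \<sigma>) \<and> \<alpha> > 0}. dist y \<tau> < e"
        by blast
    qed
  qed
qed

text \<open>The part \<open>r\<close> of a normal \<open>\<eta>\<close> orthogonal to
  \<open>D\<close> is itself a tangent direction, so \<open>r \<bullet> r \<le> 0\<close>. Testing
  with \<open>- D\<close> then fixes the sign of the remaining multiple.\<close>

lemma normal_cone_tresca: "normal_cone (tresca (f_T \<sigma>)) \<sigma> = {s *\<^sub>R D |s. s \<ge> 0}"
proof -
  have "normal_cone (tresca (f_T \<sigma>)) \<sigma>
      = {\<eta> \<in> sym_mats. \<forall>\<tau>. \<tau> \<in> sym_mats \<and> D \<bullet> \<tau> \<le> 0 \<longrightarrow> \<tau> \<bullet> \<eta> \<le> 0}"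
    by (auto simp: normal_cone_def tangent_cone_tresca ddot_eq_inner)
  also have "\<dots> = {s *\<^sub>R D |s. s \<ge> 0}"
  proof (intro set_eqI iffI; clarsimp)
    fix \<eta> assume \<eta>: "\<eta> \<in> sym_mats" "\<forall>\<tau>. \<tau> \<in> sym_mats \<and> D \<bullet> \<tau> \<le> 0 \<longrightarrow> \<tau> \<bullet> \<eta> \<le> 0"
    define s where "s = (D \<bullet> \<eta>) / 2"
    define r where "r = \<eta> - s *\<^sub>R D"
    have "D \<bullet> r = 0" by (simp add: r_def s_def inner_diff_right D_norm)
    moreover have "r \<in> sym_mats"
      unfolding r_def by (intro subspace_diff subspace_scale subspace_sym_mats \<eta> D_sym)
    ultimately have "r \<bullet> \<eta> \<le> 0" using \<eta>(2) by auto
    moreover have "r \<bullet> \<eta> = r \<bullet> r"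
      using \<open>D \<bullet> r = 0\<close> by (simp add: r_def inner_diff_right inner_diff_left inner_commute D_norm)
    ultimately have "r = 0" using inner_gt_zero_iff[of r] by linarith
    moreover have "- D \<bullet> \<eta> \<le> 0"
      using \<eta>(2)[rule_format, of "- D"] D_norm subspace_neg[OF subspace_sym_mats D_sym] by simp
    ultimately show "\<exists>s. \<eta> = s *\<^sub>R D \<and> 0 \<le> s"
      by (intro exI[of _ s]) (simp add: r_def s_def)
  next
    fix s :: real assume "0 \<le> s"
    then show "s *\<^sub>R D \<in> sym_mats \<and> (\<forall>\<tau>. \<tau> \<in> sym_mats \<and> D \<bullet> \<tau> \<le> 0 \<longrightarrow> s * (\<tau> \<bullet> D) \<le> 0)"
      by (simp add: subspace_scale subspace_sym_mats D_sym mult_le_0_iff inner_commute[of _ D])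
  qed
  finally show ?thesis .
qed

end

section \<open>Explicit projections onto half-spaces and rays\<close>

text \<open>Expanding the squared distance about \<open>x\<close> shows that the obtuse-angle
  condition forces minimality; convexity and closedness give uniqueness.\<close>

lemma closest_point_eqI:
  fixes a :: "'a::euclidean_space"
  assumes S: "convex S" "closed S" "x \<in> S" and le: "\<And>z. z \<in> S \<Longrightarrow> (a - x) \<bullet> (z - x) \<le> 0"
  shows "closest_point S a = x"
proof -
  have "dist a x \<le> dist a z" if "z \<in> S" for z
  proof -
    have "(a - z) \<bullet> (a - z) = (a - x) \<bullet> (a - x) - 2 * ((a - x) \<bullet> (z - x)) + (z - x) \<bullet> (z - x)"
      by (simp add: algebra_simps inner_commute)
    then have "(a - x) \<bullet> (a - x) \<le> (a - z) \<bullet> (a - z)"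
      using le[OF that] inner_ge_zero[of "z - x"] by linarith
    then show ?thesis by (simp add: dist_norm norm_le)
  qed
  then show ?thesis using closest_point_unique[OF S] by auto
qed

lemma closest_point_subspace_halfspace:
  fixes D :: "'a::euclidean_space"
  assumes V: "subspace V" "D \<in> V" "a \<in> V" and D: "D \<noteq> 0"
  shows "closest_point {z \<in> V. D \<bullet> z \<le> 0} a = a - (max 0 (D \<bullet> a) / (D \<bullet> D)) *\<^sub>R D"
proof (rule closest_point_eqI)
  have eq: "{z \<in> V. D \<bullet> z \<le> 0} = V \<inter> {z. D \<bullet> z \<le> 0}" by auto
  show "convex {z \<in> V. D \<bullet> z \<le> 0}" "closed {z \<in> V. D \<bullet> z \<le> 0}"
    unfolding eq using V(1)
    by (simp_all add: convex_Int closed_Int subspace_imp_convex closed_subspace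
        convex_halfspace_le closed_halfspace_le)
  show "a - (max 0 (D \<bullet> a) / (D \<bullet> D)) *\<^sub>R D \<in> {z \<in> V. D \<bullet> z \<le> 0}"
    using V D by (simp add: subspace_diff subspace_scale inner_diff_right)
  \<comment> \<open>Either nothing is subtracted from \<open>a\<close>, or the corrected point is
    orthogonal to \<open>D\<close> and the claim reduces to
    \<open>D \<bullet> z \<le> 0\<close>.\<close>
  show "(a - (a - (max 0 (D \<bullet> a) / (D \<bullet> D)) *\<^sub>R D)) \<bullet> (z - (a - (max 0 (D \<bullet> a) / (D \<bullet> D)) *\<^sub>R D)) \<le> 0"
    if "z \<in> {z \<in> V. D \<bullet> z \<le> 0}" for z
    using that D by (auto simp: max_def inner_diff_right inner_add_right mult_le_0_iff divide_le_0_iff)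
qed

lemma closest_point_ray:
  fixes D :: "'a::euclidean_space"
  assumes D: "D \<noteq> 0"
  shows "closest_point {s *\<^sub>R D |s. s \<ge> 0} a = (max 0 (D \<bullet> a) / (D \<bullet> D)) *\<^sub>R D"
proof (rule closest_point_eqI)
  \<comment> \<open>As an injective linear image of a half-line, the ray inherits convexity and
    closedness.\<close>
  have eq: "{s *\<^sub>R D |s. s \<ge> 0} = (\<lambda>s. s *\<^sub>R D) ` {0..}" by auto
  have lin: "linear (\<lambda>s. s *\<^sub>R D)" by (simp add: linear_iff scaleR_left_distrib)
  show "convex {s *\<^sub>R D |s. s \<ge> 0}"
    unfolding eq by (intro convex_linear_image lin) simp
  show "closed {s *\<^sub>R D |s. s \<ge> 0}"
    unfolding eq using D by (intro closed_injective_linear_image lin) (auto simp: inj_def)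
  show "(max 0 (D \<bullet> a) / (D \<bullet> D)) *\<^sub>R D \<in> {s *\<^sub>R D |s. s \<ge> 0}"
    by (auto intro!: exI[of _ "max 0 (D \<bullet> a) / (D \<bullet> D)"])
  show "(a - (max 0 (D \<bullet> a) / (D \<bullet> D)) *\<^sub>R D) \<bullet> (z - (max 0 (D \<bullet> a) / (D \<bullet> D)) *\<^sub>R D) \<le> 0"
    if z: "z \<in> {s *\<^sub>R D |s. s \<ge> 0}" for z
  proof -
    obtain s where s: "z = s *\<^sub>R D" "s \<ge> 0" using z by auto
    define c where "c = max 0 (D \<bullet> a) / (D \<bullet> D)"
    have "(a - c *\<^sub>R D) \<bullet> (s *\<^sub>R D - c *\<^sub>R D) = (s - c) * (D \<bullet> a - c * (D \<bullet> D))"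
      by (simp add: algebra_simps inner_commute)
    \<comment> \<open>If \<open>D \<bullet> a > 0\<close>, the residual is orthogonal to
      \<open>D\<close>; otherwise \<open>c = 0\<close> and the product has the right sign.\<close>
    also have "\<dots> = (s - c) * min 0 (D \<bullet> a)"
      using D by (simp add: c_def max_def min_def)
    also have "\<dots> \<le> 0"
      using s(2) D by (auto simp: c_def max_def min_def mult_le_0_iff)
    finally show ?thesis by (simp add: c_def s)
  qed
qed

section \<open>Explicit form of the projected flow rules\<close>

theorem theorem4p2:
  fixes k lam mu :: real
    and \<sigma> \<epsilon>' \<epsilon>e' \<epsilon>p' \<sigma>' :: "real^3^3"
    and v1 v3 :: "real^3"
  assumes "k > 0" and "lam > 0" and "mu > 0"
    and "\<sigma> \<in> sym_mats" and "f_T \<sigma> = k"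
    and "eigval \<sigma> 1 > eigval \<sigma> 2" and "eigval \<sigma> 2 > eigval \<sigma> 3"
    and "norm v1 = 1" and "\<sigma> *v v1 = eigval \<sigma> 1 *\<^sub>R v1"
    and "norm v3 = 1" and "\<sigma> *v v3 = eigval \<sigma> 3 *\<^sub>R v3"
    and "\<epsilon>' \<in> sym_mats" and "\<epsilon>e' \<in> sym_mats" and "\<epsilon>p' \<in> sym_mats" and "\<sigma>' \<in> sym_mats"
  shows "((\<epsilon>e' = closest_point (tangent_cone (tresca k) \<sigma>) \<epsilon>'
        \<and> \<epsilon>p' = closest_point (normal_cone (tresca k) \<sigma>) \<epsilon>'
        \<and> \<sigma>' = closest_point (tangent_cone (tresca k) \<sigma>) (elasticity lam mu \<epsilon>'))
      \<longleftrightarrow>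
        (\<epsilon>p' = q_mult \<epsilon>' v1 v3 *\<^sub>R (tensor v1 v1 - tensor v3 v3)
        \<and> \<epsilon>e' = \<epsilon>' - \<epsilon>p'
        \<and> \<sigma>' = (lam * trace \<epsilon>') *\<^sub>R mat 1
              + (2 * mu) *\<^sub>R (\<epsilon>' - q_mult \<epsilon>' v1 v3 *\<^sub>R (tensor v1 v1 - tensor v3 v3))))
      \<and> q_mult \<epsilon>' v1 v3 = max 0 (ddot (deviator \<epsilon>') (tensor v1 v1 - tensor v3 v3)) / 2"
proof -
  interpret simple_spectrum \<sigma> v1 v3
    using assms by unfold_locales
  have D0: "D \<noteq> 0" using D_norm by auto
  have q: "q_mult \<epsilon>' v1 v3 = max 0 (D \<bullet> \<epsilon>') / 2"
    using \<open>\<epsilon>' \<in> sym_mats\<close> by (simp add: q_mult_def ddot_eq_inner D_def inner_commute)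
  have H: "elasticity lam mu \<epsilon>' \<in> sym_mats"
    unfolding elasticity_def
    by (intro subspace_add subspace_scale subspace_sym_mats mat_1_in_sym_mats \<open>\<epsilon>' \<in> sym_mats\<close>)
  have "D \<bullet> elasticity lam mu \<epsilon>' = 2 * mu * (D \<bullet> \<epsilon>')"
    by (simp add: elasticity_def inner_add_right D_identity)
  \<comment> \<open>Positivity of \<open>mu\<close> lets the factor pass through the
    maximum.\<close>
  then have max: "max 0 (D \<bullet> elasticity lam mu \<epsilon>') = 2 * mu * max 0 (D \<bullet> \<epsilon>')"
    using \<open>mu > 0\<close> by (simp add: max_def zero_le_mult_iff)
  have T: "closest_point (tangent_cone (tresca k) \<sigma>) a = a - (max 0 (D \<bullet> a) / 2) *\<^sub>R D"
    if "a \<in> sym_mats" for a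
    using closest_point_subspace_halfspace[OF subspace_sym_mats D_sym that D0]
    by (simp add: tangent_cone_tresca D_norm flip: \<open>f_T \<sigma> = k\<close>)
  have N: "closest_point (normal_cone (tresca k) \<sigma>) \<epsilon>' = (max 0 (D \<bullet> \<epsilon>') / 2) *\<^sub>R D"
    using closest_point_ray[OF D0, of \<epsilon>']
    by (simp add: normal_cone_tresca D_norm flip: \<open>f_T \<sigma> = k\<close>)
  have S: "closest_point (tangent_cone (tresca k) \<sigma>) (elasticity lam mu \<epsilon>')
      = (lam * trace \<epsilon>') *\<^sub>R mat 1 + (2 * mu) *\<^sub>R (\<epsilon>' - (max 0 (D \<bullet> \<epsilon>') / 2) *\<^sub>R D)"
    unfolding T[OF H] max by (simp add: elasticity_def scaleR_diff_right)
  have "deviator \<epsilon>' \<in> sym_mats"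
    unfolding deviator_def
    by (intro subspace_diff subspace_scale subspace_sym_mats mat_1_in_sym_mats \<open>\<epsilon>' \<in> sym_mats\<close>)
  then have "ddot (deviator \<epsilon>') D = D \<bullet> \<epsilon>'"
    by (simp add: ddot_eq_inner inner_commute[of _ D] deviator_def inner_diff_right D_identity)
  \<comment> \<open>With all projections explicit, the elastic rates agree after substituting the
    plastic rate.\<close>
  then show ?thesis
    unfolding T[OF \<open>\<epsilon>' \<in> sym_mats\<close>] N S q D_def[symmetric] by auto
qed

end
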